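(* Let $n\ge 1$, let $A=(a_{ij})\in M_n(\mathbb{C})$ with $a_{ij}\ge 0$ for all $i,j=1,\dots,n$, and let $\xi={}^t(1,1,\dots,1)\in\mathbb{C}^n$. If $A\xi=\alpha\xi$ and $A^*\xi=\alpha\xi$ for some $\alpha\in\mathbb{C}$, then $\|A\|_{p,p}=\alpha$ for every $p\in[1,\infty]$.
   Context: For $\eta=(y_1,\dots,y_n)\in\mathbb{C}^n$, $\|\eta\|_p=(\sum_{i=1}^n|y_i|^p)^{1/p}$ for $1\le p<\infty$ and $\|\eta\|_\infty=\max_i|y_i|$. For $A\in M_n(\mathbb{C})$, $\|A\|_{p,p}=\sup\{\|A\eta\|_p:\eta\in\mathbb{C}^n,\ \|\eta\|_p=1\}$, and $A^*$ is the conjugate transpose of $A$. The condition $a_{ij}\ge 0$ means that $a_{ij}$ is a nonnegative real number. *)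

theory Defs
  imports "HOL-Analysis.Analysis"
begin

text \<open>
  The exponent is an extended real; only the values in \<open>[1, \<infinity>]\<close> are meaningful.
  Note that \<open>0 powr a = 0\<close>, so zero components contribute nothing and the zero vector has norm 0.
\<close>

definition pnorm :: "ereal \<Rightarrow> complex ^ 'n \<Rightarrow> real" where
  "pnorm p y =
     (if p = \<infinity> then Max (range (\<lambda>i. cmod (y $ i)))
      else (\<Sum>i\<in>UNIV. cmod (y $ i) powr real_of_ereal p) powr (1 / real_of_ereal p))"

text \<open>
  For \<open>p\<close> in \<open>[1, \<infinity>]\<close> the set below is nonempty and bounded above (finite dimension),
  so the real-valued \<open>Sup\<close> is the genuine supremum.
\<close>

definition pp_norm :: "ereal \<Rightarrow> complex ^ 'n ^ 'n \<Rightarrow> real" where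
  "pp_norm p A = Sup {pnorm p (A *v y) |y. pnorm p y = 1}"

definition conj_transpose :: "complex ^ 'n ^ 'm \<Rightarrow> complex ^ 'm ^ 'n" where
  "conj_transpose A = (\<chi> i j. cnj (A $ j $ i))"

end

theory Submission
  imports Defs
begin

text \<open>
  Write \<open>r\<close> for the common row sum of \<open>A\<close>. Applied to the all-ones vector, the two eigenvector
  hypotheses say that every row of \<open>A\<close> and, since conjugation fixes the real entries, every column
  of \<open>A\<close> sums to \<open>\<alpha>\<close>; thus \<open>\<alpha> = r\<close> is real and nonnegative.

  For finite \<open>p\<close> and \<open>r > 0\<close> (otherwise \<open>A = 0\<close>), the row \<open>(a\<^sub>i\<^sub>j / r)\<^sub>j\<close> is a probability distribution, so Jensen's inequality for the
  convex function \<open>x \<mapsto> x\<^sup>p\<close> gives \<open>(\<Sum>\<^sub>j a\<^sub>i\<^sub>j |y\<^sub>j|)\<^sup>p \<le> r\<^sup>p\<^sup>-\<^sup>1 \<Sum>\<^sub>j a\<^sub>i\<^sub>j |y\<^sub>j|\<^sup>p\<close>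
  (\<open>weighted_powr_mean\<close>). Summing over \<open>i\<close> and using the column sums yields
  \<open>\<parallel>Ay\<parallel>\<^sub>p \<le> r \<parallel>y\<parallel>\<^sub>p\<close> (\<open>pnorm_mult_le\<close>). For \<open>p = \<infinity>\<close> the same bound is the triangle inequality
  combined with the row sums. Equality holds at the all-ones vector, an eigenvector with eigenvalue \<open>r\<close>, so after
  normalization it realizes the supremum.
\<close>

text \<open>
  At an endpoint \<open>x = 0\<close> convexity reduces to \<open>(t y)\<^sup>p \<le> t y\<^sup>p\<close>, which holds because \<open>t\<^sup>p \<le> t\<close> for
  \<open>0 \<le> t \<le> 1 \<le> p\<close>; away from zero it is the convexity on the open half-line. The closed
  half-line is what Jensen's inequality for vectors with vanishing components calls for.
\<close>

lemma powr_convex_atLeast: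
  fixes p :: real
  assumes "p \<ge> 1"
  shows "convex_on {0..} (\<lambda>x. x powr p)"
proof -
  have shrink: "(t * y) powr p \<le> t * y powr p" if "0 \<le> t" "t \<le> 1" for t y :: real
  proof -
    have "t powr p \<le> t powr 1"
      using that assms by (intro powr_mono') auto
    then show ?thesis
      using that by (simp add: powr_mult mult_right_mono)
  qed
  show ?thesis
  proof (rule convex_onI)
    fix t x y :: real
    assume t: "0 < t" "t < 1" and "x \<in> {0..}" "y \<in> {0..}"
    then consider "x = 0" | "y = 0" | "x > 0" "y > 0" by fastforce
    then show "((1 - t) *\<^sub>R x + t *\<^sub>R y) powr p \<le> (1 - t) * x powr p + t * y powr p"
    proof cases
      case 1
      then show ?thesis using shrink[of t y] t by simp
    next
      case 2
      then show ?thesis using shrink[of "1 - t" x] t by simp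
    next
      case 3
      then show ?thesis
        using convex_onD[OF powr_convex[OF assms], of t x y] t by simp
    qed
  qed simp
qed

text \<open>
  Jensen's inequality for the weights \<open>w i / r\<close>, cleared of denominators. If \<open>r = 0\<close> all weights
  vanish, and both sides are zero.
\<close>

lemma weighted_powr_mean:
  fixes w x :: "'i \<Rightarrow> real"
  assumes "finite S" "p \<ge> 1"
    and w: "\<And>i. i \<in> S \<Longrightarrow> w i \<ge> 0" and x: "\<And>i. i \<in> S \<Longrightarrow> x i \<ge> 0"
    and r: "(\<Sum>i\<in>S. w i) = r"
  shows "(\<Sum>i\<in>S. w i * x i) powr p \<le> r powr (p - 1) * (\<Sum>i\<in>S. w i * x i powr p)"
proof (cases "r = 0")
  case True
  then have "w i = 0" if "i \<in> S" for i
    using that r w \<open>finite S\<close> by (simp add: sum_nonneg_eq_0_iff)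
  then show ?thesis by simp
next
  case False
  then have "r > 0"
    using r w by (metis sum_nonneg order_le_less)
  have "S \<noteq> {}" using False r by auto
  have "(\<Sum>i\<in>S. (w i / r) *\<^sub>R x i) powr p \<le> (\<Sum>i\<in>S. (w i / r) * x i powr p)"
    using \<open>S \<noteq> {}\<close> \<open>r > 0\<close> assms
    by (intro convex_on_sum[OF _ _ powr_convex_atLeast])
      (auto simp flip: sum_divide_distrib)
  moreover have "(\<Sum>i\<in>S. w i * x i) = r * (\<Sum>i\<in>S. (w i / r) *\<^sub>R x i)"
    using \<open>r > 0\<close> by (simp add: sum_distrib_left)
  ultimately have "(\<Sum>i\<in>S. w i * x i) powr p \<le> r powr p * (\<Sum>i\<in>S. (w i / r) * x i powr p)"
    by (simp add: powr_mult mult_left_mono)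
  also have "\<dots> = r powr (p - 1) * (\<Sum>i\<in>S. w i * x i powr p)"
    using \<open>r > 0\<close> by (simp add: powr_diff sum_distrib_left)
  finally show ?thesis .
qed

lemma pnorm_scale:
  assumes "p \<ge> 1"
  shows "pnorm p (c *s y) = cmod c * pnorm p y"
proof (cases "p = \<infinity>")
  case True
  have "Max (range (\<lambda>i. cmod c * cmod (y $ i))) = Max ((*) (cmod c) ` range (\<lambda>i. cmod (y $ i)))"
    by (simp add: image_image)
  also have "\<dots> = cmod c * Max (range (\<lambda>i. cmod (y $ i)))"
    by (intro mono_Max_commute[symmetric] monoI mult_left_mono) auto
  finally show ?thesis
    using True by (simp add: pnorm_def norm_mult)
next
  case False
  then have "real_of_ereal p \<ge> 1"
    using assms by (cases p) auto
  then show ?thesis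
    using False
    by (simp add: pnorm_def norm_mult powr_mult powr_powr flip: sum_distrib_left)
qed

lemma pnorm_ones_pos: "pnorm p ((\<chi> i. 1) :: complex ^ 'n) > 0"
  by (simp add: pnorm_def)

lemma norm_mult_component_le:
  fixes A :: "complex ^ 'n ^ 'm"
  shows "cmod ((A *v y) $ i) \<le> (\<Sum>j\<in>UNIV. cmod (A $ i $ j) * cmod (y $ j))"
  unfolding matrix_vector_mult_def
  by (simp add: sum_norm_le norm_mult)

text \<open>
  Applying Jensen's inequality in each row costs a factor \<open>r\<^bsup>p-1\<^esup>\<close> from the row sums; exchanging
  the sums then gains the last factor \<open>r\<close> from the column sums.
\<close>

lemma pnorm_mult_le:
  fixes A :: "complex ^ 'n ^ 'n"
  assumes p: "p \<ge> 1"
    and row: "\<And>i. (\<Sum>j\<in>UNIV. cmod (A $ i $ j)) = r"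
    and col: "\<And>j. (\<Sum>i\<in>UNIV. cmod (A $ i $ j)) = r"
  shows "pnorm p (A *v y) \<le> r * pnorm p y"
proof -
  have "r \<ge> 0"
    using row[of undefined] by (metis norm_ge_zero sum_nonneg)
  show ?thesis
  proof (cases "p = \<infinity>")
    case True
    define M where "M = Max (range (\<lambda>i. cmod (y $ i)))"
    have "cmod ((A *v y) $ i) \<le> r * M" for i
    proof -
      have "cmod ((A *v y) $ i) \<le> (\<Sum>j\<in>UNIV. cmod (A $ i $ j) * cmod (y $ j))"
        by (rule norm_mult_component_le)
      also have "\<dots> \<le> (\<Sum>j\<in>UNIV. cmod (A $ i $ j) * M)"
        by (intro sum_mono mult_left_mono) (auto simp: M_def)
      also have "\<dots> = r * M"
        by (simp add: row flip: sum_distrib_right)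
      finally show ?thesis .
    qed
    then show ?thesis
      using True by (simp add: pnorm_def M_def)
  next
    case False
    define q where "q = real_of_ereal p"
    have q: "q \<ge> 1"
      using p False by (cases p) (auto simp: q_def)
    have "(\<Sum>i\<in>UNIV. cmod ((A *v y) $ i) powr q)
        \<le> (\<Sum>i\<in>UNIV. (\<Sum>j\<in>UNIV. cmod (A $ i $ j) * cmod (y $ j)) powr q)"
      using q by (intro sum_mono powr_mono2 norm_mult_component_le) auto
    also have "\<dots> \<le> (\<Sum>i\<in>UNIV. r powr (q - 1) * (\<Sum>j\<in>UNIV. cmod (A $ i $ j) * cmod (y $ j) powr q))"
      using q by (intro sum_mono weighted_powr_mean row) auto
    also have "\<dots> = r powr (q - 1) * (\<Sum>i\<in>UNIV. \<Sum>j\<in>UNIV. cmod (A $ i $ j) * cmod (y $ j) powr q)"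
      by (simp add: sum_distrib_left)
    also have "(\<Sum>i\<in>UNIV. \<Sum>j\<in>UNIV. cmod (A $ i $ j) * cmod (y $ j) powr q)
        = (\<Sum>j\<in>UNIV. \<Sum>i\<in>UNIV. cmod (A $ i $ j) * cmod (y $ j) powr q)"
      by (rule sum.swap)
    also have "\<dots> = r * (\<Sum>j\<in>UNIV. cmod (y $ j) powr q)"
      by (simp add: col sum_distrib_left flip: sum_distrib_right)
    also have "r powr (q - 1) * \<dots> = r powr q * (\<Sum>j\<in>UNIV. cmod (y $ j) powr q)"
      using \<open>r \<ge> 0\<close> by (cases "r = 0") (simp_all add: powr_diff)
    finally have "(\<Sum>i\<in>UNIV. cmod ((A *v y) $ i) powr q) powr (1 / q)
        \<le> (r powr q * (\<Sum>j\<in>UNIV. cmod (y $ j) powr q)) powr (1 / q)"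
      using q by (intro powr_mono2) (auto simp: sum_nonneg)
    also have "\<dots> = r * (\<Sum>j\<in>UNIV. cmod (y $ j) powr q) powr (1 / q)"
      using q \<open>r \<ge> 0\<close> by (simp add: powr_mult powr_powr)
    finally show ?thesis
      using False by (simp add: pnorm_def q_def)
  qed
qed

theorem theorem3p5:
  fixes A :: "complex ^ 'n ^ 'n"
    and \<xi> :: "complex ^ 'n"
    and \<alpha> :: complex
  assumes nonneg: "\<And>i j. A $ i $ j \<in> \<real>\<^sub>\<ge>\<^sub>0"
    and xi: "\<xi> = (\<chi> i. 1)"
    and eig: "A *v \<xi> = \<alpha> *s \<xi>"
    and eig_adj: "conj_transpose A *v \<xi> = \<alpha> *s \<xi>"
  shows "\<forall>p \<in> {1..\<infinity>::ereal}. complex_of_real (pp_norm p A) = \<alpha>"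
proof
  fix p :: ereal
  assume "p \<in> {1..\<infinity>}"
  then have p: "p \<ge> 1" by simp
  have entry: "A $ i $ j = complex_of_real (cmod (A $ i $ j))" for i j
    using nonneg[of i j] by (auto elim: nonneg_Reals_cases)
  have entry_cnj: "cnj (A $ i $ j) = A $ i $ j" for i j
    by (subst (1 2) entry) simp
  have row_\<alpha>: "complex_of_real (\<Sum>j\<in>UNIV. cmod (A $ i $ j)) = \<alpha>" for i
    using arg_cong[OF eig, of "\<lambda>v. v $ i"]
    by (simp add: xi matrix_vector_mult_def flip: entry)
  have col_\<alpha>: "complex_of_real (\<Sum>i\<in>UNIV. cmod (A $ i $ j)) = \<alpha>" for j
    using arg_cong[OF eig_adj, of "\<lambda>v. v $ j"]
    by (simp add: xi matrix_vector_mult_def conj_transpose_def entry_cnj flip: entry)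
  define r where "r = cmod \<alpha>"
  have row: "(\<Sum>j\<in>UNIV. cmod (A $ i $ j)) = r" for i
    unfolding r_def row_\<alpha>[of i, symmetric] norm_of_real by (simp add: sum_nonneg)
  have col: "(\<Sum>i\<in>UNIV. cmod (A $ i $ j)) = r" for j
    unfolding r_def col_\<alpha>[of j, symmetric] norm_of_real by (simp add: sum_nonneg)
  have \<alpha>: "\<alpha> = complex_of_real r"
    using row_\<alpha> row by metis
  define u where "u = complex_of_real (1 / pnorm p \<xi>) *s \<xi>"
  have u: "pnorm p u = 1"
    using pnorm_ones_pos[of p, where 'n = 'n] p unfolding u_def
    by (subst pnorm_scale) (auto simp: xi norm_divide)
  have Au: "A *v u = \<alpha> *s u"
    by (simp add: u_def vector_scalar_commute eig vector_smult_assoc mult.commute)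
  have "pnorm p (A *v u) = r"
    unfolding Au pnorm_scale[OF p] u by (simp add: r_def)
  then have "pp_norm p A = r"
    unfolding pp_norm_def
    using u pnorm_mult_le[OF p row col]
    by (intro cSup_eq_maximum) (auto, metis mult.right_neutral)
  then show "complex_of_real (pp_norm p A) = \<alpha>"
    by (simp add: \<alpha>)
qed

end
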